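(* Let $e$ be a regular expression over a finite alphabet $\Sigma$, let $\pi$ be a heap and $p$ an address such that $\pi,p\models e$, and let $\mathrm{cont}$ be the continuation function with $\pi\models\mathrm{cont}$ (with $p$ as root). Then for every string $w\in\Sigma^*$, there is a run of the EKW machine \[ \langle e\,;\,[\,]\,;\,w\rangle \to^{*} \langle \varepsilon\,;\,[\,]\,;\,\epsilon_{\mathrm{str}}\rangle \] if and only if there is a run of the PW$\pi$ machine (relative to $\pi$ and $\mathrm{cont}$) \[ \langle p\,;\,w\rangle \to^{*} \langle \mathrm{null}\,;\,\epsilon_{\mathrm{str}}\rangle . \]
   Context: Regular expressions over $\Sigma$: $e ::= \varepsilon \mid a \mid e^{*} \mid e_1e_2 \mid e_1\mid e_2$ ($a\in\Sigma$); $\varepsilon$ is a constant and $\epsilon_{\mathrm{str}}$ denotes the empty string. Lists: $h::t$ is cons, $[\,]$ the empty list. $\to^*$ denotes zero or more transitions. EKW machine: configurations $\langle e;k;w\rangle$ ($e$ a regular expression, $k$ a list of regular expressions, $w$ a string), with transitions exactly: $\langle e_1\mid e_2;k;w\rangle\to\langle e_1;k;w\rangle$; $\langle e_1\mid e_2;k;w\rangle\to\langle e_2;k;w\rangle$; $\langle e_1e_2;k;w\rangle\to\langle e_1;e_2::k;w\rangle$; $\langle e^{*};k;w\rangle\to\langle e;e^{*}::k;w\rangle$; $\langle e^{*};k;w\rangle\to\langle \varepsilon;k;w\rangle$; $\langle a;k;a\,w\rangle\to\langle\varepsilon;k;w\rangle$; $\langle\varepsilon;e::k;w\rangle\to\langle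 e;k;w\rangle$. Heaps: a heap $\pi$ is a finite partial function from addresses to nodes, where there is a distinguished address $\mathrm{null}$ not in the domain of any heap. A node is one of: $a$ ($a\in\Sigma$), $\varepsilon$, $(p_1\mid p_2)$, $(p_1\bullet p_2)$, $(p_1)^{*}$, where $p_1,p_2$ are addresses. For partial functions $f_1,f_2$ with disjoint domains, $f_1\otimes f_2=f_1\cup f_2$ (undefined otherwise). The relation $\pi,p\models e$ is defined by induction on $e$: $\pi,p\models a$ iff $\pi(p)=a$ (and similarly for $\varepsilon$; in these base cases $\pi$ is the single-cell heap mapping $p$ to that node); $\pi,p\models(e_1\mid e_2)$ iff $\pi=\pi_0\otimes\pi_1\otimes\pi_2$ with $\pi_0(p)=(p_1\mid p_2)$, $\pi_1,p_1\models e_1$, $\pi_2,p_2\models e_2$; $\pi,p\models(e_1e_2)$ iff $\pi=\pi_0\otimes\pi_1\otimes\pi_2$ with $\pi_0(p)=(p_1\bullet p_2)$, $\pi_1,p_1\models e_1$, $\pi_2,p_2\models e_2$; $\pi,p\models e_1^{*}$ iff $\pi=\pi_0\otimes\pi_1$ with $\pi_0(p)=(p_1)^{*}$ and $\pi_1,p_1\models e_1$. (Thus $\pi$ lays out the syntax tree of $e$ with root $p$.) Continuation function: $\mathrm{cont}:\mathrm{dom}(\pi)\to\mathrm{dom}(\pi)\cup\{\mathrm{null}\}$ satisfies $\pi\models\mathrm{cont}$ if: whenever $\pi(q)=(q_1\mid q_2)$ then $\mathrm{cont}(q_1)=\mathrm{cont}(q_2)=\mathrm{cont}(q)$; whenever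 $\pi(q)=(q_1\bullet q_2)$ then $\mathrm{cont}(q_1)=q_2$ and $\mathrm{cont}(q_2)=\mathrm{cont}(q)$; whenever $\pi(q)=(q_1)^{*}$ then $\mathrm{cont}(q_1)=q$; and $\mathrm{cont}(p_0)=\mathrm{null}$ for the root $p_0$ of the tree. Such $\mathrm{cont}$ is uniquely determined by $\pi$ and the root. Pointer steps relative to $\pi$: $q\to q_1$ and $q\to q_2$ if $\pi(q)=q_1\mid q_2$; $q\to q_1$ if $\pi(q)=q_1\bullet q_2$; $q\to q_1$ and $q\to\mathrm{cont}(q)$ if $\pi(q)=(q_1)^{*}$; $q\to\mathrm{cont}(q)$ if $\pi(q)=\varepsilon$; and $q\xrightarrow{a}\mathrm{cont}(q)$ if $\pi(q)=a$. The PW$\pi$ machine has configurations $\langle q;w\rangle$ with $q$ an address (possibly $\mathrm{null}$) and $w$ a string, and transitions $\langle q;a\,w\rangle\to\langle q';w\rangle$ whenever $q\xrightarrow{a}q'$, and $\langle q;w\rangle\to\langle q';w\rangle$ whenever $q\to q'$. The address $\mathrm{null}$ has no outgoing steps. *)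

theory Defs
  imports Main
begin

datatype (atoms: 'a) rexp =
    Eps
  | Atom 'a
  | Star "'a rexp"
  | Seq "'a rexp" "'a rexp"
  | Alt "'a rexp" "'a rexp"

type_synonym 'a ekw_config = "'a rexp \<times> 'a rexp list \<times> 'a list"

inductive ekw_step :: "'a ekw_config \<Rightarrow> 'a ekw_config \<Rightarrow> bool" where
  ekw_alt1: "ekw_step (Alt e1 e2, k, w) (e1, k, w)"
| ekw_alt2: "ekw_step (Alt e1 e2, k, w) (e2, k, w)"
| ekw_seq: "ekw_step (Seq e1 e2, k, w) (e1, e2 # k, w)"
| ekw_star1: "ekw_step (Star e, k, w) (e, Star e # k, w)"
| ekw_star2: "ekw_step (Star e, k, w) (Eps, k, w)"
| ekw_atom: "ekw_step (Atom a, k, a # w) (Eps, k, w)"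
| ekw_eps: "ekw_step (Eps, e # k, w) (e, k, w)"

datatype ('p, 'a) node =
    NAtom 'a
  | NEps
  | NAlt 'p 'p
  | NSeq 'p 'p
  | NStar 'p

type_synonym ('p, 'a) heap = "'p \<rightharpoonup> ('p, 'a) node"

definition is_heap :: "'p \<Rightarrow> ('p, 'a) heap \<Rightarrow> bool" where
  "is_heap null \<pi> \<longleftrightarrow> finite (dom \<pi>) \<and> null \<notin> dom \<pi>"

definition disj :: "('p \<rightharpoonup> 'b) \<Rightarrow> ('p \<rightharpoonup> 'b) \<Rightarrow> bool" where
  "disj f g \<longleftrightarrow> dom f \<inter> dom g = {}"

text \<open>
  A decomposition \<open>\<pi> = \<pi>0 \<otimes> \<pi>1 \<otimes> \<pi>2\<close> is rendered as \<open>\<pi> = \<pi>0 ++ \<pi>1 ++ \<pi>2\<close> with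
  pairwise disjoint domains. In the compound cases the part \<open>\<pi>0\<close> is only required
  to hold the root node at \<open>p\<close>; it is not required to be a single cell.
\<close>

fun sat :: "('p, 'a) heap \<Rightarrow> 'p \<Rightarrow> 'a rexp \<Rightarrow> bool" where
  "sat \<pi> p (Atom a) \<longleftrightarrow> \<pi> = [p \<mapsto> NAtom a]"
| "sat \<pi> p Eps \<longleftrightarrow> \<pi> = [p \<mapsto> NEps]"
| "sat \<pi> p (Alt e1 e2) \<longleftrightarrow>
     (\<exists>\<pi>0 \<pi>1 \<pi>2 p1 p2. \<pi> = \<pi>0 ++ \<pi>1 ++ \<pi>2 \<and> disj \<pi>0 \<pi>1 \<and> disj \<pi>0 \<pi>2 \<and> disj \<pi>1 \<pi>2 \<and>
        \<pi>0 p = Some (NAlt p1 p2) \<and> sat \<pi>1 p1 e1 \<and> sat \<pi>2 p2 e2)"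
| "sat \<pi> p (Seq e1 e2) \<longleftrightarrow>
     (\<exists>\<pi>0 \<pi>1 \<pi>2 p1 p2. \<pi> = \<pi>0 ++ \<pi>1 ++ \<pi>2 \<and> disj \<pi>0 \<pi>1 \<and> disj \<pi>0 \<pi>2 \<and> disj \<pi>1 \<pi>2 \<and>
        \<pi>0 p = Some (NSeq p1 p2) \<and> sat \<pi>1 p1 e1 \<and> sat \<pi>2 p2 e2)"
| "sat \<pi> p (Star e1) \<longleftrightarrow>
     (\<exists>\<pi>0 \<pi>1 p1. \<pi> = \<pi>0 ++ \<pi>1 \<and> disj \<pi>0 \<pi>1 \<and>
        \<pi>0 p = Some (NStar p1) \<and> sat \<pi>1 p1 e1)"

definition models_cont :: "'p \<Rightarrow> ('p, 'a) heap \<Rightarrow> 'p \<Rightarrow> ('p \<rightharpoonup> 'p) \<Rightarrow> bool" where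
  "models_cont null \<pi> p0 cont \<longleftrightarrow>
     dom cont = dom \<pi> \<and> ran cont \<subseteq> dom \<pi> \<union> {null} \<and>
     (\<forall>q q1 q2. \<pi> q = Some (NAlt q1 q2) \<longrightarrow> cont q1 = cont q \<and> cont q2 = cont q) \<and>
     (\<forall>q q1 q2. \<pi> q = Some (NSeq q1 q2) \<longrightarrow> cont q1 = Some q2 \<and> cont q2 = cont q) \<and>
     (\<forall>q q1. \<pi> q = Some (NStar q1) \<longrightarrow> cont q1 = Some q) \<and>
     cont p0 = Some null"

inductive ptr_eps_step :: "('p, 'a) heap \<Rightarrow> ('p \<rightharpoonup> 'p) \<Rightarrow> 'p \<Rightarrow> 'p \<Rightarrow> bool"
  for \<pi> :: "('p, 'a) heap" and cont :: "'p \<rightharpoonup> 'p" where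
  ptr_alt1: "\<pi> q = Some (NAlt q1 q2) \<Longrightarrow> ptr_eps_step \<pi> cont q q1"
| ptr_alt2: "\<pi> q = Some (NAlt q1 q2) \<Longrightarrow> ptr_eps_step \<pi> cont q q2"
| ptr_seq: "\<pi> q = Some (NSeq q1 q2) \<Longrightarrow> ptr_eps_step \<pi> cont q q1"
| ptr_star1: "\<pi> q = Some (NStar q1) \<Longrightarrow> ptr_eps_step \<pi> cont q q1"
| ptr_star2: "\<pi> q = Some (NStar q1) \<Longrightarrow> cont q = Some q' \<Longrightarrow> ptr_eps_step \<pi> cont q q'"
| ptr_eps: "\<pi> q = Some NEps \<Longrightarrow> cont q = Some q' \<Longrightarrow> ptr_eps_step \<pi> cont q q'"

inductive ptr_atom_step :: "('p, 'a) heap \<Rightarrow> ('p \<rightharpoonup> 'p) \<Rightarrow> 'p \<Rightarrow> 'a \<Rightarrow> 'p \<Rightarrow> bool"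
  for \<pi> :: "('p, 'a) heap" and cont :: "'p \<rightharpoonup> 'p" where
  ptr_atom: "\<pi> q = Some (NAtom a) \<Longrightarrow> cont q = Some q' \<Longrightarrow> ptr_atom_step \<pi> cont q a q'"

inductive pw_step :: "('p, 'a) heap \<Rightarrow> ('p \<rightharpoonup> 'p) \<Rightarrow> 'p \<times> 'a list \<Rightarrow> 'p \<times> 'a list \<Rightarrow> bool"
  for \<pi> :: "('p, 'a) heap" and cont :: "'p \<rightharpoonup> 'p" where
  pw_atom: "ptr_atom_step \<pi> cont q a q' \<Longrightarrow> pw_step \<pi> cont (q, a # w) (q', w)"
| pw_eps: "ptr_eps_step \<pi> cont q q' \<Longrightarrow> pw_step \<pi> cont (q, w) (q', w)"

end

theory Submission
  imports Defs
begin

text \<open>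
  The two machines simulate each other. A list \<open>k\<close> of regular expressions is represented by an
  address \<open>q\<close> when \<open>q\<close>, \<open>cont q\<close>, \<open>cont (cont q)\<close>, \dots are the roots of syntax trees of the
  members of \<open>k\<close> and the chain ends in \<open>null\<close>. An EKW configuration \<open>\<langle>e; k; w\<rangle>\<close> corresponds to
  \<open>\<langle>q; w\<rangle>\<close> if \<open>q\<close> represents \<open>e :: k\<close>, or if \<open>e = \<epsilon>\<close> and \<open>q\<close> represents \<open>k\<close>. The second
  alternative is needed because EKW passes through \<open>\<epsilon>\<close> after a letter or after leaving a star,
  whereas the pointer machine jumps to the continuation at once.
\<close>

section \<open>Syntax trees in a heap, without separation\<close>

text \<open>Unlike \<^const>\<open>sat\<close>, this is monotone in the heap and does not ask for disjointness.\<close>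

fun tree :: "('p, 'a) heap \<Rightarrow> 'p \<Rightarrow> 'a rexp \<Rightarrow> bool" where
  "tree \<pi> p (Atom a) \<longleftrightarrow> \<pi> p = Some (NAtom a)"
| "tree \<pi> p Eps \<longleftrightarrow> \<pi> p = Some NEps"
| "tree \<pi> p (Alt e1 e2) \<longleftrightarrow>
     (\<exists>p1 p2. \<pi> p = Some (NAlt p1 p2) \<and> tree \<pi> p1 e1 \<and> tree \<pi> p2 e2)"
| "tree \<pi> p (Seq e1 e2) \<longleftrightarrow>
     (\<exists>p1 p2. \<pi> p = Some (NSeq p1 p2) \<and> tree \<pi> p1 e1 \<and> tree \<pi> p2 e2)"
| "tree \<pi> p (Star e1) \<longleftrightarrow> (\<exists>p1. \<pi> p = Some (NStar p1) \<and> tree \<pi> p1 e1)"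

lemma tree_mono: "tree \<pi> p e \<Longrightarrow> \<pi> \<subseteq>\<^sub>m \<pi>' \<Longrightarrow> tree \<pi>' p e"
  by (induction e arbitrary: p) (fastforce simp: map_le_def dom_def)+

lemma tree_in_dom: "tree \<pi> p e \<Longrightarrow> p \<in> dom \<pi>"
  by (cases e) auto

lemma map_le_add_disj:
  assumes "disj f g"
  shows "f \<subseteq>\<^sub>m f ++ g"
  using assms map_add_comm[of f g]
  by (metis disj_def map_le_map_add)

lemma map_le_add3_disj:
  assumes "disj f g" "disj f h" "disj g h"
  shows "f \<subseteq>\<^sub>m f ++ g ++ h" "g \<subseteq>\<^sub>m f ++ g ++ h" "h \<subseteq>\<^sub>m f ++ g ++ h"
proof -
  have "disj (f ++ g) h" using assms by (auto simp: disj_def)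
  then have le: "f ++ g \<subseteq>\<^sub>m f ++ g ++ h" by (rule map_le_add_disj)
  show "f \<subseteq>\<^sub>m f ++ g ++ h"
    using map_le_trans[OF map_le_add_disj[OF assms(1)] le] .
  show "g \<subseteq>\<^sub>m f ++ g ++ h"
    using map_le_trans[OF map_le_map_add le] .
  show "h \<subseteq>\<^sub>m f ++ g ++ h" by simp
qed

lemma map_le_SomeD: "f \<subseteq>\<^sub>m g \<Longrightarrow> f x = Some y \<Longrightarrow> g x = Some y"
  by (force simp: map_le_def dom_def)

text \<open>Disjointness keeps any part from being overwritten in the union, so each part is a
  submap of \<open>\<pi>\<close>, and the trees that the induction finds in the parts persist in
  \<open>\<pi>\<close>.\<close>

lemma sat_imp_tree: "sat \<pi> p e \<Longrightarrow> tree \<pi> p e"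
proof (induction e arbitrary: \<pi> p)
  case (Star e)
  then obtain \<pi>0 \<pi>1 p1 where *: "\<pi> = \<pi>0 ++ \<pi>1" "disj \<pi>0 \<pi>1"
      "\<pi>0 p = Some (NStar p1)" "sat \<pi>1 p1 e"
    by auto
  have "\<pi> p = Some (NStar p1)"
    using map_le_SomeD[OF map_le_add_disj] * by metis
  moreover have "tree \<pi> p1 e"
    using tree_mono[OF Star.IH[OF *(4)]] *(1) by simp
  ultimately show ?case by simp
next
  case (Seq e1 e2)
  then obtain \<pi>0 \<pi>1 \<pi>2 p1 p2 where *: "\<pi> = \<pi>0 ++ \<pi>1 ++ \<pi>2"
      "disj \<pi>0 \<pi>1" "disj \<pi>0 \<pi>2" "disj \<pi>1 \<pi>2"
      "\<pi>0 p = Some (NSeq p1 p2)" "sat \<pi>1 p1 e1" "sat \<pi>2 p2 e2"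
    by auto
  note le = map_le_add3_disj[OF *(2-4), folded *(1)]
  show ?case
    using map_le_SomeD[OF le(1) *(5)] tree_mono[OF Seq.IH(1)[OF *(6)] le(2)]
      tree_mono[OF Seq.IH(2)[OF *(7)] le(3)] by auto
next
  case (Alt e1 e2)
  then obtain \<pi>0 \<pi>1 \<pi>2 p1 p2 where *: "\<pi> = \<pi>0 ++ \<pi>1 ++ \<pi>2"
      "disj \<pi>0 \<pi>1" "disj \<pi>0 \<pi>2" "disj \<pi>1 \<pi>2"
      "\<pi>0 p = Some (NAlt p1 p2)" "sat \<pi>1 p1 e1" "sat \<pi>2 p2 e2"
    by auto
  note le = map_le_add3_disj[OF *(2-4), folded *(1)]
  show ?case
    using map_le_SomeD[OF le(1) *(5)] tree_mono[OF Alt.IH(1)[OF *(6)] le(2)]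
      tree_mono[OF Alt.IH(2)[OF *(7)] le(3)] by auto
qed auto

section \<open>Stacks as chains of continuations\<close>

text \<open>The trees along a chain may overlap: once a star is entered, the tree of its body lies
  inside the tree of the star that comes next in the list. Hence \<open>tree\<close> rather than
  \<open>sat\<close>.\<close>

fun represents :: "'p \<Rightarrow> ('p, 'a) heap \<Rightarrow> ('p \<rightharpoonup> 'p) \<Rightarrow> 'p \<Rightarrow> 'a rexp list \<Rightarrow> bool" where
  "represents null \<pi> cont q [] \<longleftrightarrow> q = null"
| "represents null \<pi> cont q (e # k) \<longleftrightarrow>
     tree \<pi> q e \<and> (\<exists>r. cont q = Some r \<and> represents null \<pi> cont r k)"

fun related :: "'p \<Rightarrow> ('p, 'a) heap \<Rightarrow> ('p \<rightharpoonup> 'p) \<Rightarrow> 'a ekw_config \<Rightarrow> 'p \<times> 'a list \<Rightarrow> bool" where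
  "related null \<pi> cont (e, k, w) (q, v) \<longleftrightarrow>
     v = w \<and> (represents null \<pi> cont q (e # k) \<or> e = Eps \<and> represents null \<pi> cont q k)"

lemma models_contD:
  assumes "models_cont null \<pi> p cont"
  shows "\<pi> q = Some (NAlt q1 q2) \<Longrightarrow> cont q1 = cont q \<and> cont q2 = cont q"
    and "\<pi> q = Some (NSeq q1 q2) \<Longrightarrow> cont q1 = Some q2 \<and> cont q2 = cont q"
    and "\<pi> q = Some (NStar q1) \<Longrightarrow> cont q1 = Some q"
    and "cont p = Some null"
  using assms unfolding models_cont_def by blast+

section \<open>The pointer machine simulates EKW\<close>

text \<open>Each EKW step costs at most one pointer step; it costs none when it pops past an
  \<open>Eps\<close> that the pointer has already left behind.\<close>

lemma ekw_step_simulated: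
  assumes "models_cont null \<pi> p cont" "ekw_step c c'" "related null \<pi> cont c d"
  shows "\<exists>d'. (pw_step \<pi> cont)\<^sup>*\<^sup>* d d' \<and> related null \<pi> cont c' d'"
proof -
  note cont = models_contD[OF assms(1)]
  obtain q w where d: "d = (q, w)" by fastforce
  show ?thesis using assms(2)
  proof cases
    case (ekw_alt1 e1 e2 k v)
    then obtain q1 q2 where "\<pi> q = Some (NAlt q1 q2)" "related null \<pi> cont c' (q1, w)"
      using assms(3) cont(1) unfolding d by fastforce
    then show ?thesis unfolding d by (blast intro: pw_eps ptr_alt1)
  next
    case (ekw_alt2 e1 e2 k v)
    then obtain q1 q2 where "\<pi> q = Some (NAlt q1 q2)" "related null \<pi> cont c' (q2, w)"
      using assms(3) cont(1) unfolding d by fastforce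
    then show ?thesis unfolding d by (blast intro: pw_eps ptr_alt2)
  next
    case (ekw_seq e1 e2 k v)
    \<comment> \<open>The chain from \<open>q1\<close> goes to \<open>q2\<close> and then continues
      like that of \<open>q\<close>, which mirrors the push of \<open>e2\<close>.\<close>
    then obtain q1 q2 where "\<pi> q = Some (NSeq q1 q2)" "related null \<pi> cont c' (q1, w)"
      using assms(3) cont(2) unfolding d by fastforce
    then show ?thesis unfolding d by (blast intro: pw_eps ptr_seq)
  next
    case (ekw_star1 e k v)
    \<comment> \<open>The chain from \<open>q1\<close> returns to \<open>q\<close>, the root of the
      tree of \<open>Star e\<close>, which mirrors the push of \<open>Star e\<close>.\<close>
    then obtain q1 where "\<pi> q = Some (NStar q1)" "related null \<pi> cont c' (q1, w)"
      using assms(3) cont(3) unfolding d by fastforce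
    then show ?thesis unfolding d by (blast intro: pw_eps ptr_star1)
  next
    case (ekw_star2 e k v)
    then obtain q1 r where "\<pi> q = Some (NStar q1)" "cont q = Some r" "related null \<pi> cont c' (r, w)"
      using assms(3) unfolding d by fastforce
    then show ?thesis unfolding d by (blast intro: pw_eps ptr_star2)
  next
    case (ekw_atom a k v)
    then obtain r where "\<pi> q = Some (NAtom a)" "cont q = Some r" "related null \<pi> cont c' (r, v)"
        "w = a # v"
      using assms(3) unfolding d by fastforce
    then show ?thesis unfolding d by (blast intro: pw_atom ptr_atom)
  next
    case (ekw_eps e k v)
    then consider "related null \<pi> cont c' d"
      | r where "\<pi> q = Some NEps" "cont q = Some r" "related null \<pi> cont c' (r, w)"
      using assms(3) unfolding d by fastforce
    then show ?thesis
    proof cases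
      case 1
      then show ?thesis by blast
    next
      case 2
      then show ?thesis unfolding d by (blast intro: pw_eps ptr_eps)
    qed
  qed
qed

lemma ekw_steps_simulated:
  assumes "models_cont null \<pi> p cont" "ekw_step\<^sup>*\<^sup>* c c'" "related null \<pi> cont c d"
  shows "\<exists>d'. (pw_step \<pi> cont)\<^sup>*\<^sup>* d d' \<and> related null \<pi> cont c' d'"
  using assms(2)
proof induction
  case base
  then show ?case using assms(3) by blast
next
  case (step c' c'')
  then show ?case using ekw_step_simulated[OF assms(1)] by (meson rtranclp_trans)
qed

section \<open>EKW simulates the pointer machine\<close>

text \<open>The tree at \<open>q\<close> fixes the node stored there and thereby the possible
  pointer steps. Each of them is matched by an EKW step for the same constructor, except at
  \<open>Eps\<close>.\<close>

lemma represented_step_simulated: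
  assumes "models_cont null \<pi> p cont" "pw_step \<pi> cont (q, w) d'"
    and "represents null \<pi> cont q (e # k)"
  shows "\<exists>c'. ekw_step\<^sup>*\<^sup>* (e, k, w) c' \<and> related null \<pi> cont c' d'"
proof -
  note cont = models_contD[OF assms(1)]
  from assms(3) obtain r where r: "tree \<pi> q e" "cont q = Some r" "represents null \<pi> cont r k"
    by auto
  show ?thesis
  proof (cases e)
    case Eps
    then have "d' = (r, w)"
      using assms(2) r by (auto elim!: pw_step.cases ptr_eps_step.cases ptr_atom_step.cases)
    \<comment> \<open>EKW stays where it is and its pop is postponed: \<open>k\<close> may be empty,
      and then EKW has no transition.\<close>
    then have "related null \<pi> cont (e, k, w) d'" using Eps r by simp
    then show ?thesis by blast
  next
    case (Atom a)
    then obtain v where "w = a # v" "d' = (r, v)"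
      using assms(2) r by (auto elim!: pw_step.cases ptr_eps_step.cases ptr_atom_step.cases)
    moreover from this have "related null \<pi> cont (Eps, k, v) d'" using r by simp
    ultimately show ?thesis using Atom by (blast intro: ekw_atom)
  next
    case (Star e1)
    then obtain q1 where q1: "\<pi> q = Some (NStar q1)" "tree \<pi> q1 e1" using r by auto
    then have "d' = (r, w) \<or> d' = (q1, w)"
      using assms(2) r by (auto elim!: pw_step.cases ptr_eps_step.cases ptr_atom_step.cases)
    then have "related null \<pi> cont (Eps, k, w) d' \<or> related null \<pi> cont (e1, e # k, w) d'"
      using Star q1 r cont(3) by auto
    then show ?thesis unfolding Star by (blast intro: ekw_star1 ekw_star2)
  next
    case (Seq e1 e2)
    then obtain q1 q2 where q: "\<pi> q = Some (NSeq q1 q2)" "tree \<pi> q1 e1" "tree \<pi> q2 e2"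
      using r by auto
    then have "d' = (q1, w)"
      using assms(2) by (auto elim!: pw_step.cases ptr_eps_step.cases ptr_atom_step.cases)
    then have "related null \<pi> cont (e1, e2 # k, w) d'"
      using q r cont(2) by auto
    then show ?thesis unfolding Seq by (blast intro: ekw_seq)
  next
    case (Alt e1 e2)
    then obtain q1 q2 where q: "\<pi> q = Some (NAlt q1 q2)" "tree \<pi> q1 e1" "tree \<pi> q2 e2"
      using r by auto
    then have "d' = (q1, w) \<or> d' = (q2, w)"
      using assms(2) by (auto elim!: pw_step.cases ptr_eps_step.cases ptr_atom_step.cases)
    then have "related null \<pi> cont (e1, k, w) d' \<or> related null \<pi> cont (e2, k, w) d'"
      using q r cont(1) by auto
    then show ?thesis unfolding Alt by (blast intro: ekw_alt1 ekw_alt2)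
  qed
qed

lemma pw_step_in_dom: "pw_step \<pi> cont (q, w) d' \<Longrightarrow> q \<in> dom \<pi>"
  by (auto elim!: pw_step.cases ptr_eps_step.cases ptr_atom_step.cases)

lemma pw_step_simulated:
  assumes "models_cont null \<pi> p cont" "null \<notin> dom \<pi>"
    and "pw_step \<pi> cont d d'" "related null \<pi> cont c d"
  shows "\<exists>c'. ekw_step\<^sup>*\<^sup>* c c' \<and> related null \<pi> cont c' d'"
proof -
  obtain e k w where c: "c = (e, k, w)" by (cases c)
  with assms(4) obtain q where d: "d = (q, w)" by (cases d) auto
  from assms(4) consider "represents null \<pi> cont q (e # k)"
    | "e = Eps" "represents null \<pi> cont q k"
    unfolding c d by auto
  then show ?thesis
  proof cases
    case 1
    then show ?thesis
      using represented_step_simulated[OF assms(1)] assms(3) unfolding c d by blast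
  next
    case 2
    \<comment> \<open>An address with an outgoing step holds a node, so it cannot represent the
      empty list.\<close>
    have "q \<noteq> null" using pw_step_in_dom assms(2,3) unfolding d by metis
    then obtain e' k' where k: "k = e' # k'" using 2 by (cases k) auto
    obtain c' where "ekw_step\<^sup>*\<^sup>* (e', k', w) c'" "related null \<pi> cont c' d'"
      using represented_step_simulated[OF assms(1)] assms(3) 2 unfolding d k by blast
    \<comment> \<open>The postponed pop is made up for here, before the step that matches the
      pointer.\<close>
    moreover have "ekw_step c (e', k', w)" unfolding c k 2 by (rule ekw_eps)
    ultimately show ?thesis by (meson converse_rtranclp_into_rtranclp)
  qed
qed

lemma pw_steps_simulated:
  assumes "models_cont null \<pi> p cont" "null \<notin> dom \<pi>"
    and "(pw_step \<pi> cont)\<^sup>*\<^sup>* d d'" "related null \<pi> cont c d"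
  shows "\<exists>c'. ekw_step\<^sup>*\<^sup>* c c' \<and> related null \<pi> cont c' d'"
  using assms(3)
proof induction
  case base
  then show ?case using assms(4) by blast
next
  case (step d' d'')
  then show ?case using pw_step_simulated[OF assms(1,2)] by (meson rtranclp_trans)
qed

section \<open>Initial and accepting configurations\<close>

lemma related_accepting_ekw:
  assumes "related null \<pi> cont (Eps, [], []) d"
  shows "(pw_step \<pi> cont)\<^sup>*\<^sup>* d (null, [])"
proof -
  obtain q where d: "d = (q, [])" using assms by (cases d) auto
  \<comment> \<open>The pointer may still be at an \<open>Eps\<close> leaf whose continuation is
    \<open>null\<close>, for instance when the whole expression is \<open>Eps\<close>; one more step
    then accepts.\<close>
  then have "q = null \<or> \<pi> q = Some NEps \<and> cont q = Some null" using assms by auto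
  then show ?thesis unfolding d by (blast intro: pw_eps ptr_eps)
qed

text \<open>No node is stored at \<open>null\<close>, so it represents only the empty list. This
  rules out the first alternative of \<open>related\<close>.\<close>

lemma related_accepting_pw:
  assumes "related null \<pi> cont c (null, [])" "null \<notin> dom \<pi>"
  shows "c = (Eps, [], [])"
proof -
  obtain e k w where c: "c = (e, k, w)" by (cases c)
  have no_cons: "\<not> represents null \<pi> cont null (e' # k')" for e' k'
    using tree_in_dom assms(2) by fastforce
  then have "w = [] \<and> e = Eps \<and> represents null \<pi> cont null k" using assms(1) unfolding c by auto
  with no_cons show ?thesis unfolding c by (cases k) auto
qed

theorem theorem2:
  fixes \<Sigma> :: "'a set" and e :: "'a rexp"
    and null p :: 'p and \<pi> :: "('p, 'a) heap" and cont :: "'p \<rightharpoonup> 'p"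
  assumes "finite \<Sigma>" and "atoms e \<subseteq> \<Sigma>"
    and "is_heap null \<pi>" and "sat \<pi> p e"
    and "models_cont null \<pi> p cont"
  shows "\<forall>w \<in> lists \<Sigma>.
    ekw_step\<^sup>*\<^sup>* (e, [], w) (Eps, [], []) \<longleftrightarrow> (pw_step \<pi> cont)\<^sup>*\<^sup>* (p, w) (null, [])"
proof (intro ballI iffI)
  fix w
  have null: "null \<notin> dom \<pi>" using assms(3) by (simp add: is_heap_def)
  \<comment> \<open>Since \<open>cont p = Some null\<close>, the root represents the one-element
    list \<open>[e]\<close>.\<close>
  have init: "related null \<pi> cont (e, [], w) (p, w)"
    using sat_imp_tree[OF assms(4)] models_contD(4)[OF assms(5)] by simp
  show "(pw_step \<pi> cont)\<^sup>*\<^sup>* (p, w) (null, [])" if "ekw_step\<^sup>*\<^sup>* (e, [], w) (Eps, [], [])"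
    using ekw_steps_simulated[OF assms(5) that init] related_accepting_ekw
    by (meson rtranclp_trans)
  show "ekw_step\<^sup>*\<^sup>* (e, [], w) (Eps, [], [])" if "(pw_step \<pi> cont)\<^sup>*\<^sup>* (p, w) (null, [])"
    using pw_steps_simulated[OF assms(5) null that init] related_accepting_pw[OF _ null]
    by blast
qed

end
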